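(* Let $\Omega$ be a Hausdorff space with Borel $\sigma$-algebra $\mathcal{B}$. Any continuous negative definite kernel $L:\Omega\times\Omega\to[0,\infty)$ belongs to the Cover-Hart class of loss functions on $\Omega$.
   Context: Let $\mathcal{P}$ be the family of the Radon probability measures on the Hausdorff space $(\Omega,\mathcal{B})$, where $\mathcal{B}$ is the Borel $\sigma$-algebra. A function $L:\Omega\times\Omega\to\mathbb{R}$ is called measurable if it is measurable with respect to either argument when the other argument is fixed. A function $L:\Omega\times\Omega\to[0,\infty)$ is a negative definite kernel if it is symmetric in its arguments, $L(y,y)=0$ for all $y\in\Omega$, and $$\sum_{i=1}^n\sum_{j=1}^n a_i a_j\, L(y_i,y_j)\leq 0$$ for all finite systems of points $y_1,\ldots,y_n\in\Omega$ and coefficients $a_1,\ldots,a_n\in\mathbb{R}$ such that $a_1+\cdots+a_n=0$. The Cover-Hart class consists of the measurable functions $L:\Omega\times\Omega\to[0,\infty)$ such that $L(y,y)=0$ for all $y\in\Omega$, and $$\alpha \equiv \inf_{y\in\Omega} \mathbb{E}_P\, L(y,Y') \;\leq\; \beta \equiv \mathbb{E}_P\, L(Y,Y') \;\leq\; 2\alpha$$ for all $P\in\mathcal{P}$, where $Y$ and $Y'$ are independent with distribution $P$. Expectations of nonnegative functions may take the value $+\infty$. *)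

theory Defs
  imports "HOL-Probability.Probability"
begin

text \<open>Radon probability measures: Borel probability measures that are inner regular with respect
  to compact sets (local finiteness is automatic for finite measures).\<close>

definition radon_prob :: "'a::t2_space measure \<Rightarrow> bool" where
  "radon_prob P \<longleftrightarrow> prob_space P \<and> sets P = sets borel \<and>
     (\<forall>B\<in>sets borel. emeasure P B = (SUP K\<in>{K. compact K \<and> K \<subseteq> B}. emeasure P K))"

definition separately_measurable :: "('a::topological_space \<Rightarrow> 'a \<Rightarrow> real) \<Rightarrow> bool" where
  "separately_measurable L \<longleftrightarrow>
     (\<forall>y. (\<lambda>y'. L y y') \<in> borel_measurable borel) \<and>
     (\<forall>y'. (\<lambda>y. L y y') \<in> borel_measurable borel)"

definition negative_definite_kernel :: "('a \<Rightarrow> 'a \<Rightarrow> real) \<Rightarrow> bool" where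
  "negative_definite_kernel L \<longleftrightarrow>
     (\<forall>x y. 0 \<le> L x y) \<and> (\<forall>x y. L x y = L y x) \<and> (\<forall>y. L y y = 0) \<and>
     (\<forall>(n::nat) (y :: nat \<Rightarrow> 'a) (a :: nat \<Rightarrow> real). (\<Sum>i=1..n. a i) = 0 \<longrightarrow>
        (\<Sum>i=1..n. \<Sum>j=1..n. a i * a j * L (y i) (y j)) \<le> 0)"

text \<open>A pair of independent variables with distribution \<^term>\<open>P\<close> has distribution
  \<^term>\<open>P \<Otimes>\<^sub>M P\<close>. Expectations are extended nonnegative integrals, so they may be infinite.\<close>

definition risk_at :: "'a measure \<Rightarrow> ('a \<Rightarrow> 'a \<Rightarrow> real) \<Rightarrow> 'a \<Rightarrow> ennreal" where
  "risk_at P L y = (\<integral>\<^sup>+ y'. ennreal (L y y') \<partial>P)"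

definition bayes_risk :: "'a measure \<Rightarrow> ('a \<Rightarrow> 'a \<Rightarrow> real) \<Rightarrow> ennreal" where
  "bayes_risk P L = (INF y. risk_at P L y)"

definition pair_risk :: "'a measure \<Rightarrow> ('a \<Rightarrow> 'a \<Rightarrow> real) \<Rightarrow> ennreal" where
  "pair_risk P L = (\<integral>\<^sup>+ (y, y'). ennreal (L y y') \<partial>(P \<Otimes>\<^sub>M P))"

text \<open>Separate measurability does not make the expectation of \<open>L(Y, Y')\<close> meaningful, and
  \<^const>\<open>nn_integral\<close> of a non-measurable function is only a lower integral. The class therefore
  states explicitly that this expectation exists for every \<open>P\<close>. Measurability is with respect to
  the completed product: on a general Hausdorff space even a continuous \<open>L\<close> may fail to be
  measurable for the product of the Borel sigma-algebras. Passing to the completion does not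
  change the value of \<^const>\<open>nn_integral\<close>.\<close>

definition cover_hart_class :: "('a::t2_space \<Rightarrow> 'a \<Rightarrow> real) set" where
  "cover_hart_class = {L.
     (\<forall>y y'. 0 \<le> L y y') \<and> separately_measurable L \<and> (\<forall>y. L y y = 0) \<and>
     (\<forall>P. radon_prob P \<longrightarrow>
        (\<lambda>(y, y'). L y y') \<in> borel_measurable (completion (P \<Otimes>\<^sub>M P)) \<and>
        bayes_risk P L \<le> pair_risk P L \<and> pair_risk P L \<le> 2 * bayes_risk P L)}"

end

theory Submission
  imports Defs
begin

text \<open>The bound \<open>\<beta> \<le> 2 \<alpha>\<close> is a sampling argument. Let \<open>Y\<^sub>1, \<dots>, Y\<^sub>n\<close> be independent
  with distribution \<open>P\<close> and let \<open>z\<close> be any point. Negative definiteness for the points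
  \<open>Y\<^sub>1, \<dots>, Y\<^sub>n, z\<close> with weights \<open>1, \<dots>, 1, -n\<close> says that
  \<open>(\<Sum>i j. L Y\<^sub>i Y\<^sub>j) \<le> 2 n (\<Sum>i. L z Y\<^sub>i)\<close>. Taking expectations gives
  \<open>n (n - 1) \<beta> \<le> 2 n\<^sup>2 E L(z, Y)\<close>, and \<open>n \<rightarrow> \<infinity>\<close> gives \<open>\<beta> \<le> 2 E L(z, Y)\<close>. All terms are
  nonnegative, so the argument runs in \<^typ>\<open>ennreal\<close>, where the expectations may be infinite
  (\<open>negative_definite_kernel_sample_le\<close>, \<open>nn_integral_pair_le_of_sample_bound\<close>).

  The bound \<open>\<alpha> \<le> \<beta>\<close> says that an infimum is at most an average: by Fubini, \<open>\<beta>\<close> is the mean of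
  \<open>E L(y, Y')\<close> over \<open>y\<close>.

  The delicate point is measurability, since on a large Hausdorff space a continuous \<open>L\<close> may fail to
  be measurable for the product of the Borel sigma-algebras. On a product of compact sets it is
  measurable, because the tube lemma makes it there a uniform limit of functions that are piecewise
  constant in the first argument (\<open>continuous_borel_measurable_on_compact_rectangle\<close>). A Radon
  probability measure is concentrated on a countable union \<open>S\<close> of compact sets
  (\<open>radon_prob_sigma_compact_core\<close>), so \<open>L\<close> agrees almost everywhere with the product-measurable
  function equal to \<open>L\<close> on \<open>S \<times> S\<close> and to \<open>0\<close> elsewhere. This gives measurability for the completed product and
  supplies the function to which Fubini and the sampling argument are applied.\<close>

section \<open>Continuous functions on products of compact sets\<close>

text \<open>By the tube lemma every point \<open>c\<close> has a neighbourhood on which \<open>f (x, y)\<close> stays within \<open>e\<close> of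
  \<open>f (c, y)\<close> simultaneously for all \<open>y \<in> B\<close>. Finitely many of these neighbourhoods cover \<open>A\<close>, and
  choosing one of their centres for each \<open>x\<close> in a Borel way yields \<open>g\<close>.\<close>

lemma continuous_uniform_approx_on_compact_rectangle:
  fixes f :: "'a::topological_space \<times> 'b::topological_space \<Rightarrow> real"
  assumes f: "continuous_on UNIV f" and A: "compact A" and B: "compact B" and e: "0 < e"
  obtains g where "g \<in> borel_measurable (borel \<Otimes>\<^sub>M borel)"
    and "\<And>x y. x \<in> A \<Longrightarrow> y \<in> B \<Longrightarrow> \<bar>g (x, y) - f (x, y)\<bar> < e"
proof -
  have "\<exists>U. c \<in> U \<and> open U \<and> (\<forall>x\<in>U. \<forall>y\<in>B. \<bar>f (c, y) - f (x, y)\<bar> < e)" for c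
  proof -
    define W where "W = {(x, y). \<bar>f (c, y) - f (x, y)\<bar> < e}"
    have "continuous_on UNIV (\<lambda>p. \<bar>f (c, snd p) - f (fst p, snd p)\<bar>)"
      by (intro continuous_intros continuous_on_compose2[OF f]) auto
    then have "open W"
      using open_Collect_less[of "\<lambda>p. \<bar>f (c, snd p) - f (fst p, snd p)\<bar>" "\<lambda>_. e"]
      by (simp add: W_def case_prod_unfold)
    moreover have "{c} \<times> B \<subseteq> W" using e by (auto simp: W_def)
    ultimately have "\<exists>U. c \<in> U \<and> open U \<and> U \<times> B \<subseteq> W"
      by (rule Elementary_Topology.tube_lemma[OF B])
    then show ?thesis unfolding W_def by blast
  qed
  then obtain U where U: "\<And>c. c \<in> U c" "\<And>c. open (U c)"
    "\<And>c x y. x \<in> U c \<Longrightarrow> y \<in> B \<Longrightarrow> \<bar>f (c, y) - f (x, y)\<bar> < e"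
    by metis
  obtain C where C: "finite C" "A \<subseteq> (\<Union>c\<in>C. U c)"
  proof (rule compactE_image[OF A, of A U])
    show "A \<subseteq> (\<Union>c\<in>A. U c)" using U(1) by blast
  qed (use U(2) that in auto)
  have "\<exists>g\<in>borel_measurable (borel \<Otimes>\<^sub>M borel).
      \<forall>x\<in>(\<Union>c\<in>C. U c). \<forall>y\<in>B. \<bar>g (x, y) - f (x, y)\<bar> < e"
    using C(1)
  proof (induction C)
    case empty
    then show ?case by (intro bexI[of _ "\<lambda>_. 0"]) auto
  next
    case (insert c C)
    then obtain g where g[measurable]: "g \<in> borel_measurable (borel \<Otimes>\<^sub>M borel)"
      and gf: "\<forall>x\<in>(\<Union>c\<in>C. U c). \<forall>y\<in>B. \<bar>g (x, y) - f (x, y)\<bar> < e" by auto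
    have [measurable]: "(\<lambda>y. f (c, y)) \<in> borel_measurable borel"
      by (intro borel_measurable_continuous_onI continuous_on_compose2[OF f] continuous_intros) auto
    have [measurable]: "U c \<in> sets borel" using U(2) by auto
    show ?case
      using gf U(3)
      by (intro bexI[of _ "\<lambda>p. if fst p \<in> U c then f (c, snd p) else g p"]) auto
  qed
  with C(2) that show thesis by (metis subsetD)
qed

lemma continuous_borel_measurable_on_compact_rectangle:
  fixes f :: "'a::t2_space \<times> 'b::t2_space \<Rightarrow> real"
  assumes f: "continuous_on UNIV f" and A: "compact A" and B: "compact B"
  shows "(\<lambda>p. indicator (A \<times> B) p * f p) \<in> borel_measurable (borel \<Otimes>\<^sub>M borel)"
proof -
  have [measurable]: "A \<in> sets borel" "B \<in> sets borel"
    using A B by (auto intro: borel_compact)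
  have "\<exists>g\<in>borel_measurable (borel \<Otimes>\<^sub>M borel).
      \<forall>x\<in>A. \<forall>y\<in>B. \<bar>g (x, y) - f (x, y)\<bar> < inverse (real (Suc n))" for n
    using continuous_uniform_approx_on_compact_rectangle[OF f A B, of "inverse (real (Suc n))"]
    by (metis inverse_positive_iff_positive of_nat_0_less_iff zero_less_Suc)
  then obtain g where g[measurable]: "\<And>n. g n \<in> borel_measurable (borel \<Otimes>\<^sub>M borel)"
    and gf: "\<And>n x y. x \<in> A \<Longrightarrow> y \<in> B \<Longrightarrow> \<bar>g n (x, y) - f (x, y)\<bar> < inverse (real (Suc n))"
    by metis
  have "(\<lambda>n. g n (x, y)) \<longlonglongrightarrow> f (x, y)" if "x \<in> A" "y \<in> B" for x y
    using LIMSEQ_norm_0[of "\<lambda>n. g n (x, y) - f (x, y)"] gf[OF that]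
    by (simp add: LIM_zero_iff inverse_eq_divide)
  then have "(\<lambda>n. indicator (A \<times> B) p * g n p) \<longlonglongrightarrow> indicator (A \<times> B) p * f p" for p
    by (cases p) (auto simp: indicator_def)
  then show ?thesis
    by (rule borel_measurable_LIMSEQ_real) measurable
qed

section \<open>Expectations over independent samples\<close>

lemma (in prob_space) PiM_pair_marginal:
  assumes "finite I" "i \<in> I" "j \<in> I" "i \<noteq> j"
  shows "distr (Pi\<^sub>M I (\<lambda>_. M)) (M \<Otimes>\<^sub>M M) (\<lambda>\<omega>. (\<omega> i, \<omega> j)) = M \<Otimes>\<^sub>M M"
proof -
  have "sigma_finite_measure M" by unfold_locales
  interpret product_prob_space "\<lambda>_. M" I by unfold_locales
  have [measurable]: "(\<lambda>\<omega>. \<omega> i) \<in> Pi\<^sub>M I (\<lambda>_. M) \<rightarrow>\<^sub>M M" "(\<lambda>\<omega>. \<omega> j) \<in> Pi\<^sub>M I (\<lambda>_. M) \<rightarrow>\<^sub>M M"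
    using assms by (auto intro: measurable_component_singleton)
  have "emeasure (distr (Pi\<^sub>M I (\<lambda>_. M)) (M \<Otimes>\<^sub>M M) (\<lambda>\<omega>. (\<omega> i, \<omega> j))) (A \<times> B) =
      emeasure M A * emeasure M B" if [measurable]: "A \<in> sets M" "B \<in> sets M" for A B
  proof -
    have "emeasure (distr (Pi\<^sub>M I (\<lambda>_. M)) (M \<Otimes>\<^sub>M M) (\<lambda>\<omega>. (\<omega> i, \<omega> j))) (A \<times> B) =
        emeasure (Pi\<^sub>M I (\<lambda>_. M))
          {\<omega> \<in> space (Pi\<^sub>M I (\<lambda>_. M)). \<forall>k\<in>{i, j}. \<omega> k \<in> (if k = i then A else B)}"
      using assms(4) by (subst emeasure_distr) (auto intro!: arg_cong2[where f = emeasure])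
    also have "\<dots> = emeasure M A * emeasure M B"
      using assms by (subst emeasure_PiM_Collect) auto
    finally show ?thesis .
  qed
  then show ?thesis
    by (intro pair_measure_eqI[symmetric]) (auto intro: \<open>sigma_finite_measure M\<close>)
qed

lemma ennreal_le_if_nat_mult_le_Suc_mult:
  fixes a b :: ennreal
  assumes "\<And>n. of_nat n * a \<le> of_nat (Suc n) * b"
  shows "a \<le> b"
proof (cases "b = \<top>")
  case False
  with assms[of 1] have "a \<noteq> \<top>"
    by (auto simp: top_unique ennreal_mult_eq_top_iff)
  with False obtain s t where st: "a = ennreal s" "b = ennreal t" "0 \<le> s" "0 \<le> t"
    by (metis ennreal_cases)
  have le: "real n * s \<le> real (Suc n) * t" for n
    using assms[of n] st
    by (simp add: ennreal_of_nat_eq_real_of_nat ennreal_mult[symmetric] del: of_nat_Suc)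
  have "s \<le> t"
  proof (rule ccontr)
    assume "\<not> s \<le> t"
    then obtain n where "t < real n * (s - t)"
      using reals_Archimedean3[of "s - t"] by auto
    with le[of n] show False by (simp add: algebra_simps)
  qed
  with st show ?thesis by (simp add: ennreal_leI)
qed simp

text \<open>Integrating the bound over the \<open>n\<close>-fold product measure turns each of the \<open>n (n - 1)\<close>
  off-diagonal terms into the integral over \<open>M \<Otimes>\<^sub>M M\<close>. The diagonal has to be left out because
  \<open>(\<omega> i, \<omega> i)\<close> is not distributed as \<open>M \<Otimes>\<^sub>M M\<close>; its share vanishes as \<open>n\<close> grows.\<close>

lemma (in prob_space) nn_integral_pair_le_of_sample_bound:
  assumes h[measurable]: "h \<in> borel_measurable (M \<Otimes>\<^sub>M M)" and g[measurable]: "g \<in> borel_measurable M"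
    and bound: "\<And>n \<omega>. (\<Sum>i=1..n. \<Sum>j\<in>{1..n} - {i}. h (\<omega> i, \<omega> j)) \<le> 2 * of_nat n * (\<Sum>i=1..n. g (\<omega> i))"
  shows "(\<integral>\<^sup>+ p. h p \<partial>(M \<Otimes>\<^sub>M M)) \<le> 2 * (\<integral>\<^sup>+ x. g x \<partial>M)"
proof (rule ennreal_le_if_nat_mult_le_Suc_mult)
  fix m :: nat
  \<comment> \<open>With \<open>m + 1\<close> points each index has \<open>m\<close> partners; the common factor \<open>n\<close> cancels at the end.\<close>
  define n where "n = Suc m"
  let ?S = "Pi\<^sub>M {1..n} (\<lambda>_. M)"
  let ?\<beta> = "\<integral>\<^sup>+ p. h p \<partial>(M \<Otimes>\<^sub>M M)" and ?\<alpha> = "\<integral>\<^sup>+ x. g x \<partial>M"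
  have [measurable]: "(\<lambda>\<omega>. h (\<omega> i, \<omega> j)) \<in> borel_measurable ?S" if "i \<in> {1..n}" "j \<in> {1..n}" for i j
    using that by (intro measurable_compose[OF _ h] measurable_Pair measurable_component_singleton)
  have pair: "(\<integral>\<^sup>+ \<omega>. h (\<omega> i, \<omega> j) \<partial>?S) = ?\<beta>" if "i \<in> {1..n}" "j \<in> {1..n} - {i}" for i j
    using that
    by (subst PiM_pair_marginal[of "{1..n}" i j, symmetric])
       (auto intro!: nn_integral_distr[symmetric] measurable_Pair measurable_component_singleton)
  have single: "(\<integral>\<^sup>+ \<omega>. g (\<omega> i) \<partial>?S) = ?\<alpha>" if "i \<in> {1..n}" for i
    using that prob_space_axioms
    by (subst distr_PiM_component[of "{1..n}" "\<lambda>_. M" i, symmetric])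
       (auto intro!: nn_integral_distr[symmetric] measurable_component_singleton)
  have "of_nat n * (of_nat m * ?\<beta>) = (\<Sum>i=1..n. \<Sum>j\<in>{1..n} - {i}. ?\<beta>)"
    by (simp add: n_def)
  also have "\<dots> = (\<Sum>i=1..n. \<Sum>j\<in>{1..n} - {i}. \<integral>\<^sup>+ \<omega>. h (\<omega> i, \<omega> j) \<partial>?S)"
    by (intro sum.cong refl pair[symmetric])
  also have "\<dots> = (\<integral>\<^sup>+ \<omega>. (\<Sum>i=1..n. \<Sum>j\<in>{1..n} - {i}. h (\<omega> i, \<omega> j)) \<partial>?S)"
    by (auto simp: nn_integral_sum simp del: One_nat_def intro!: sum.cong nn_integral_sum[symmetric])
  also have "\<dots> \<le> (\<integral>\<^sup>+ \<omega>. 2 * of_nat n * (\<Sum>i=1..n. g (\<omega> i)) \<partial>?S)"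
    by (intro nn_integral_mono bound)
  also have "\<dots> = 2 * of_nat n * (\<Sum>i=1..n. \<integral>\<^sup>+ \<omega>. g (\<omega> i) \<partial>?S)"
    by (simp add: nn_integral_cmult nn_integral_sum)
  also have "\<dots> = of_nat n * (of_nat n * (2 * ?\<alpha>))"
    using single by (simp add: ac_simps)
  finally have "of_nat n * (of_nat m * ?\<beta>) \<le> of_nat n * (of_nat n * (2 * ?\<alpha>))" .
  then show "of_nat m * ?\<beta> \<le> of_nat (Suc m) * (2 * ?\<alpha>)"
    by (subst (asm) ennreal_mult_le_mult_iff) (auto simp: n_def)
qed

text \<open>The defining inequality for the points \<open>x 1, \<dots>, x n, z\<close> with weights \<open>1, \<dots>, 1, -n\<close>: the two
  mixed sums give the right-hand side, and \<open>L z z\<close> vanishes.\<close>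

lemma negative_definite_kernel_sample_le:
  assumes "negative_definite_kernel L"
  shows "(\<Sum>i=1..n. \<Sum>j=1..n. L (x i) (x j)) \<le> 2 * real n * (\<Sum>i=1..n. L z (x i))"
proof -
  define y where "y i = (if i = Suc n then z else x i)" for i
  define a where "a i = (if i = Suc n then - real n else 1)" for i
  have "(\<Sum>i=1..Suc n. a i) = 0"
    by (simp add: a_def)
  with assms have "(\<Sum>i=1..Suc n. \<Sum>j=1..Suc n. a i * a j * L (y i) (y j)) \<le> 0"
    unfolding negative_definite_kernel_def by blast
  moreover have "L z z = 0" "\<And>i. L (x i) z = L z (x i)"
    using assms by (auto simp: negative_definite_kernel_def)
  ultimately show ?thesis
    by (simp add: a_def y_def sum.distrib sum_subtractf sum_distrib_left sum_negf algebra_simps)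
qed

section \<open>Measurable versions under Radon measures\<close>

lemma borel_measurable_completion_AE_cong:
  fixes f g :: "'a \<Rightarrow> 'b::topological_space"
  assumes g: "g \<in> borel_measurable M" and eq: "AE x in M. f x = g x"
  shows "f \<in> borel_measurable (completion M)"
proof (rule measurableI)
  fix A :: "'b set" assume A: "A \<in> sets borel"
  from eq obtain N where N: "N \<in> null_sets M" "{x \<in> space M. f x \<noteq> g x} \<subseteq> N"
    by (auto elim!: AE_E simp: null_sets_def)
  have "f -` A \<inter> space M = (g -` A \<inter> space M - N) \<union> (f -` A \<inter> space M \<inter> N)"
    using N(2) by auto
  moreover have "g -` A \<inter> space M - N \<in> sets M"
    using measurable_sets[OF g A] N(1) by auto
  ultimately show "f -` A \<inter> space (completion M) \<in> sets (completion M)"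
    unfolding space_completion by (rule sets_completionI[OF _ Int_lower2 N(1)])
qed simp

text \<open>Inner regularity of the whole space makes its mass \<open>1\<close> a supremum of masses of compact sets. A
  sequence whose masses approach it has a union of full mass, and finite unions make it increasing.\<close>

lemma radon_prob_sigma_compact_core:
  assumes "radon_prob P"
  obtains K :: "nat \<Rightarrow> 'a::t2_space set" where "\<And>n. compact (K n)" "incseq K" "AE x in P. x \<in> (\<Union>n. K n)"
proof -
  interpret prob_space P using assms by (simp add: radon_prob_def)
  have sets[measurable_cong]: "sets P = sets borel" using assms by (simp add: radon_prob_def)
  have space[simp]: "space P = UNIV" using sets_eq_imp_space_eq[OF sets] by simp
  have "(SUP K\<in>{K. compact K}. emeasure P K) = 1"
    using assms emeasure_space_1 by (auto simp: radon_prob_def)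
  then obtain C :: "nat \<Rightarrow> ennreal"
    where C: "range C \<subseteq> emeasure P ` {K. compact K}" "(SUP n. C n) = (1::ennreal)"
    using ennreal_Sup_countable_SUP[of "emeasure P ` {K. compact K}"] by (auto intro: compact_empty)
  have "\<exists>K. compact K \<and> emeasure P K = C n" for n
  proof -
    have "C n \<in> emeasure P ` {K. compact K}" using C(1) by auto
    then show ?thesis by (elim imageE) auto
  qed
  then obtain K where K: "\<And>n. compact (K n)" "\<And>n. emeasure P (K n) = C n" by metis
  define K' where "K' n = (\<Union>i\<le>n. K i)" for n
  have [measurable]: "K n \<in> sets P" for n using K(1) sets by (auto intro: borel_compact)
  have "(SUP n. C n) \<le> emeasure P (\<Union>n. K n)"
    unfolding K(2)[symmetric] by (intro SUP_least emeasure_mono) auto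
  then have "emeasure P (\<Union>n. K n) = 1"
    using C(2) emeasure_le_1 by (intro antisym) auto
  then have "AE x in P. x \<in> (\<Union>n. K n)"
    by (intro AE_prob_1) (simp add: measure_def)
  moreover have "(\<Union>n. K' n) = (\<Union>n. K n)" by (auto simp: K'_def)
  ultimately show thesis
    using K(1) by (intro that[of K']) (auto 0 3 simp: K'_def incseq_def intro!: compact_UN intro: order_trans)
qed

text \<open>The compact squares \<open>K n \<times> K n\<close> of an increasing sequence exhaust the square \<open>S \<times> S\<close> of its
  union, so the cutoff of \<open>f\<close> to \<open>S \<times> S\<close> is a pointwise limit of cutoffs to compact squares.\<close>

lemma radon_prob_continuous_product_measurable_version:
  fixes f :: "'a::t2_space \<times> 'a \<Rightarrow> real"
  assumes P: "radon_prob P" and f: "continuous_on UNIV f"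
  obtains S where "S \<in> sets P" "AE x in P. x \<in> S"
    "(\<lambda>p. indicator (S \<times> S) p * f p) \<in> borel_measurable (P \<Otimes>\<^sub>M P)"
proof -
  have sets[measurable_cong]: "sets P = sets borel" using P by (simp add: radon_prob_def)
  obtain K where K: "\<And>n. compact (K n)" "incseq K" "AE x in P. x \<in> (\<Union>n. K n)"
    using radon_prob_sigma_compact_core[OF P] by blast
  define S where "S = (\<Union>n. K n)"
  have "(\<lambda>n. indicator (K n \<times> K n) p :: real) \<longlonglongrightarrow> indicator (\<Union>n. K n \<times> K n) p" for p
    using K(2) by (intro LIMSEQ_indicator_incseq) (fastforce simp: incseq_def)
  moreover have "(\<Union>n. K n \<times> K n) = S \<times> S"
  proof -
    have "(x, y) \<in> K (max m n) \<times> K (max m n)" if "x \<in> K m" "y \<in> K n" for x y m n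
      using that incseqD[OF K(2), of m "max m n"] incseqD[OF K(2), of n "max m n"] by auto
    then show ?thesis by (fastforce simp: S_def)
  qed
  ultimately have "(\<lambda>n. indicator (K n \<times> K n) p * f p) \<longlonglongrightarrow> indicator (S \<times> S) p * f p" for p
    by (intro tendsto_mult tendsto_const) simp
  then have "(\<lambda>p. indicator (S \<times> S) p * f p) \<in> borel_measurable (borel \<Otimes>\<^sub>M borel)"
    by (rule borel_measurable_LIMSEQ_real)
       (rule continuous_borel_measurable_on_compact_rectangle[OF f K(1) K(1)])
  moreover have "sets (P \<Otimes>\<^sub>M P) = sets (borel \<Otimes>\<^sub>M borel)"
    using sets by (intro sets_pair_measure_cong)
  ultimately have "(\<lambda>p. indicator (S \<times> S) p * f p) \<in> borel_measurable (P \<Otimes>\<^sub>M P)"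
    by (simp cong: measurable_cong_sets)
  moreover have "S \<in> sets P"
    using K(1) unfolding S_def sets by (auto intro: borel_compact)
  ultimately show thesis
    using that K(3) by (simp add: S_def)
qed

section \<open>Negative definite kernels in the Cover-Hart class\<close>

theorem theorem2p4:
  fixes L :: "'a::t2_space \<Rightarrow> 'a \<Rightarrow> real"
  assumes "negative_definite_kernel L"
    and "continuous_on UNIV (\<lambda>(y, y'). L y y')"
  shows "L \<in> cover_hart_class"
proof -
  have L_nonneg: "0 \<le> L x y" and L_diag: "L x x = 0" for x y
    using assms(1) by (auto simp: negative_definite_kernel_def)
  have continuous_sections: "continuous_on UNIV (\<lambda>y'. L y y')" "continuous_on UNIV (\<lambda>x. L x y)" for y
    using continuous_on_compose2[OF assms(2), of UNIV "\<lambda>y'. (y, y')"]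
      continuous_on_compose2[OF assms(2), of UNIV "\<lambda>x. (x, y)"]
    by (simp_all add: continuous_on_Pair)
  have sections: "(\<lambda>y'. L y y') \<in> borel_measurable borel" "(\<lambda>x. L x y) \<in> borel_measurable borel" for y
    by (rule borel_measurable_continuous_onI[OF continuous_sections(1)])
       (rule borel_measurable_continuous_onI[OF continuous_sections(2)])
  have "(\<lambda>(y, y'). L y y') \<in> borel_measurable (completion (P \<Otimes>\<^sub>M P)) \<and>
        bayes_risk P L \<le> pair_risk P L \<and> pair_risk P L \<le> 2 * bayes_risk P L"
    if P: "radon_prob P" for P
  proof -
    interpret prob_space P using P by (simp add: radon_prob_def)
    interpret PP: pair_prob_space P P ..
    have sets[measurable_cong]: "sets P = sets borel" using P by (simp add: radon_prob_def)
    obtain S where S[measurable]: "S \<in> sets P" and S_AE: "AE x in P. x \<in> S"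
      and meas: "(\<lambda>p. indicator (S \<times> S) p * (case p of (y, y') \<Rightarrow> L y y')) \<in> borel_measurable (P \<Otimes>\<^sub>M P)"
      using radon_prob_continuous_product_measurable_version[OF P assms(2)] by blast
    \<comment> \<open>A product-measurable version of \<open>L\<close>; being below \<open>L\<close> everywhere, it inherits the upper bound
      on sample sums at every sample.\<close>
    define h where "h p = indicator (S \<times> S) p * (case p of (y, y') \<Rightarrow> L y y')" for p
    have h[measurable]: "h \<in> borel_measurable (P \<Otimes>\<^sub>M P)" using meas by (simp add: h_def[abs_def])
    have h_le: "h (x, y) \<le> L x y" and h_eq: "x \<in> S \<Longrightarrow> y \<in> S \<Longrightarrow> h (x, y) = L x y" for x y
      using L_nonneg by (auto simp: h_def indicator_def)
    have "AE p in P \<Otimes>\<^sub>M P. p \<in> S \<times> S"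
      using S_AE by (intro PP.AE_pair_measure) auto
    then have L_h: "AE p in P \<Otimes>\<^sub>M P. (case p of (y, y') \<Rightarrow> L y y') = h p"
      by eventually_elim (auto simp: h_def)
    have pair_risk_h: "pair_risk P L = (\<integral>\<^sup>+ p. ennreal (h p) \<partial>(P \<Otimes>\<^sub>M P))"
      unfolding pair_risk_def
      by (rule nn_integral_cong_AE) (use L_h in \<open>eventually_elim, auto\<close>)

    have "bayes_risk P L = (\<integral>\<^sup>+ x. bayes_risk P L \<partial>P)"
      by (simp add: emeasure_space_1)
    also have "\<dots> \<le> (\<integral>\<^sup>+ x. risk_at P L x \<partial>P)"
      unfolding bayes_risk_def by (intro nn_integral_mono INF_lower) simp
    also have "\<dots> = (\<integral>\<^sup>+ x. \<integral>\<^sup>+ y. ennreal (h (x, y)) \<partial>P \<partial>P)"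
    proof (rule nn_integral_cong_AE, rule AE_mp[OF S_AE], intro AE_I2 impI)
      fix x assume "x \<in> S"
      have "AE y in P. ennreal (L x y) = ennreal (h (x, y))"
        using S_AE by eventually_elim (simp add: h_eq \<open>x \<in> S\<close>)
      then show "risk_at P L x = (\<integral>\<^sup>+ y. ennreal (h (x, y)) \<partial>P)"
        unfolding risk_at_def by (rule nn_integral_cong_AE)
    qed
    also have "\<dots> = pair_risk P L"
      unfolding pair_risk_h by (intro nn_integral_fst) measurable
    finally have lower: "bayes_risk P L \<le> pair_risk P L" .

    have "pair_risk P L \<le> 2 * risk_at P L z" for z
      unfolding pair_risk_h risk_at_def
    proof (rule nn_integral_pair_le_of_sample_bound)
      fix n and \<omega> :: "nat \<Rightarrow> 'a"
      have "(\<Sum>i=1..n. \<Sum>j\<in>{1..n} - {i}. ennreal (h (\<omega> i, \<omega> j))) \<le>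
          (\<Sum>i=1..n. \<Sum>j\<in>{1..n} - {i}. ennreal (L (\<omega> i) (\<omega> j)))"
        by (intro sum_mono ennreal_leI h_le)
      also have "\<dots> \<le> (\<Sum>i=1..n. \<Sum>j=1..n. ennreal (L (\<omega> i) (\<omega> j)))"
        by (intro sum_mono sum_mono2) auto
      also have "\<dots> = ennreal (\<Sum>i=1..n. \<Sum>j=1..n. L (\<omega> i) (\<omega> j))"
        by (simp add: L_nonneg sum_nonneg)
      also have "\<dots> \<le> ennreal (2 * real n * (\<Sum>i=1..n. L z (\<omega> i)))"
        by (intro ennreal_leI negative_definite_kernel_sample_le assms)
      also have "\<dots> = 2 * of_nat n * (\<Sum>i=1..n. ennreal (L z (\<omega> i)))"
        by (simp add: L_nonneg sum_nonneg ennreal_mult ennreal_of_nat_eq_real_of_nat)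
      finally show "(\<Sum>i=1..n. \<Sum>j\<in>{1..n} - {i}. ennreal (h (\<omega> i, \<omega> j))) \<le>
          2 * of_nat n * (\<Sum>i=1..n. ennreal (L z (\<omega> i)))" .
    qed (use sections in measurable)
    then have "pair_risk P L / 2 \<le> bayes_risk P L"
      unfolding bayes_risk_def by (intro INF_greatest divide_le_posI_ennreal) auto
    then have "2 * (pair_risk P L / 2) \<le> 2 * bayes_risk P L"
      by (intro mult_left_mono) auto
    then have "pair_risk P L \<le> 2 * bayes_risk P L"
      by (simp add: ennreal_times_divide mult.commute[of 2] ennreal_mult_divide_eq)
    then show ?thesis
      using lower borel_measurable_completion_AE_cong[OF h L_h] by blast
  qed
  with L_nonneg L_diag sections show ?thesis
    unfolding cover_hart_class_def separately_measurable_def by blast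
qed

end
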